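(* Let $n\geq 4$, $A\in\mathcal{PC}_n$ and $w\in\mathcal{E}(A)$. Then there are $i,j\in\{1,\ldots,n\}$, with $i\neq j$, such that $w(i)\in\mathcal{E}(A(i))$ and $w(j)\in\mathcal{E}(A(j))$; that is, $w\in\mathcal{E}(A;i)\cap\mathcal{E}(A;j)$.
   Context: $\mathcal{PC}_n$ is the set of $n$-by-$n$ reciprocal matrices: entrywise positive real matrices $A=[a_{ij}]$ with $a_{ji}=1/a_{ij}$ for all $1\leq i,j\leq n$. $\mathcal{V}_n$ is the set of entrywise positive real $n$-vectors. A vector $w\in\mathcal{V}_n$ is efficient for $A\in\mathcal{PC}_n$ if for every $v\in\mathcal{V}_n$, the entrywise inequalities $\left|a_{ij}-\frac{v_i}{v_j}\right|\leq\left|a_{ij}-\frac{w_i}{w_j}\right|$ for all $i,j$ imply that $v$ is proportional to $w$. $\mathcal{E}(A)$ is the set of all efficient vectors for $A$. $A(i)$ is the principal submatrix of $A$ obtained by deleting row and column $i$, and $w(i)$ is the vector obtained from $w$ by deleting its $i$th entry. (If $A$ is reciprocal, so is $A(i)$.) $\mathcal{E}(A;i)$ is the set of $w\in\mathcal{E}(A)$ such that $w(i)\in\mathcal{E}(A(i))$. *)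

theory Defs
  imports "Jordan_Normal_Form.Determinant"
begin

(* Indices run over 0, ..., n - 1. *)

definition reciprocal_mats :: "nat \<Rightarrow> real mat set" where
  "reciprocal_mats n =
     {A \<in> carrier_mat n n.
        (\<forall>i<n. \<forall>j<n. A $$ (i, j) > 0) \<and> (\<forall>i<n. \<forall>j<n. A $$ (j, i) = 1 / A $$ (i, j))}"

definition positive_vecs :: "nat \<Rightarrow> real vec set" where
  "positive_vecs n = {w \<in> carrier_vec n. \<forall>i<n. w $ i > 0}"

definition proportional :: "real vec \<Rightarrow> real vec \<Rightarrow> bool" where
  "proportional v w \<longleftrightarrow> (\<exists>c. v = c \<cdot>\<^sub>v w)"

definition efficient_vecs :: "real mat \<Rightarrow> real vec set" where
  "efficient_vecs A =
     {w \<in> positive_vecs (dim_row A).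
        \<forall>v \<in> positive_vecs (dim_row A).
          (\<forall>i<dim_row A. \<forall>j<dim_row A.
             \<bar>A $$ (i, j) - v $ i / v $ j\<bar> \<le> \<bar>A $$ (i, j) - w $ i / w $ j\<bar>)
          \<longrightarrow> proportional v w}"

(* The vector analogue of mat_delete. *)
definition vec_delete :: "'a vec \<Rightarrow> nat \<Rightarrow> 'a vec" where
  "vec_delete w i = vec (dim_vec w - 1) (\<lambda>k. w $ (if k < i then k else Suc k))"

definition efficient_vecs_at :: "real mat \<Rightarrow> nat \<Rightarrow> real vec set" where
  "efficient_vecs_at A i =
     {w \<in> efficient_vecs A. vec_delete w i \<in> efficient_vecs (mat_delete A i i)}"

lemma mat_delete_reciprocal:
  assumes "A \<in> reciprocal_mats n" and "i < n"
  shows "mat_delete A i i \<in> reciprocal_mats (n - 1)"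
proof -
  let ?f = "\<lambda>k. if k < i then k else Suc k"
  have f: "?f k < n" if "k < n - 1" for k
    using that by auto
  have A: "A \<in> carrier_mat n n"
    and pos: "\<And>k l. k < n \<Longrightarrow> l < n \<Longrightarrow> A $$ (k, l) > 0"
    and rec: "\<And>k l. k < n \<Longrightarrow> l < n \<Longrightarrow> A $$ (l, k) = 1 / A $$ (k, l)"
    using assms(1) unfolding reciprocal_mats_def by blast+
  have carrier: "mat_delete A i i \<in> carrier_mat (n - 1) (n - 1)"
    using A by (rule mat_delete_carrier)
  have entry: "mat_delete A i i $$ (k, l) = A $$ (?f k, ?f l)" if "k < n - 1" "l < n - 1" for k l
    using A that by (simp add: mat_delete_def)
  have "mat_delete A i i $$ (k, l) > 0" if "k < n - 1" "l < n - 1" for k l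
    unfolding entry[OF that] using that by (intro pos f)
  moreover have "mat_delete A i i $$ (l, k) = 1 / mat_delete A i i $$ (k, l)"
    if "k < n - 1" "l < n - 1" for k l
    unfolding entry[OF that] entry[OF that(2,1)] using that by (intro rec f)
  ultimately show ?thesis
    unfolding reciprocal_mats_def using carrier by blast
qed

lemma vec_delete_positive:
  assumes "w \<in> positive_vecs n" and "i < n"
  shows "vec_delete w i \<in> positive_vecs (n - 1)"
  using assms by (auto simp: positive_vecs_def vec_delete_def)

end

theory Submission
  imports Defs
begin

text \<open>
  To a vector \<open>w\<close> and a matrix \<open>A\<close> belongs a digraph, with an edge from \<open>i\<close> to \<open>j\<close> when
  \<open>w\<^sub>i / w\<^sub>j\<close> is at least \<open>a\<^sub>i\<^sub>j\<close>. For reciprocal \<open>A\<close>, efficiency of \<open>w\<close> is equivalent to strong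
  connectivity of this digraph (lemmas \<open>efficient_imp_strong\<close> and \<open>strong_imp_efficient\<close>): a set of
  vertices without outgoing edges can be scaled up to improve \<open>w\<close>, and conversely the ratio
  \<open>v\<^sub>i / w\<^sub>i\<close> cannot decrease along an edge when \<open>v\<close> is at least as good as \<open>w\<close>, so strong
  connectivity forces it to be constant.

  Deleting an index from \<open>A\<close> and \<open>w\<close> deletes a vertex from the digraph, and reciprocity makes the
  digraph semicomplete: any two vertices are joined in at least one direction. So the theorem
  becomes a statement on strong semicomplete digraphs with at least four vertices: two different
  vertices can each be deleted without destroying strong connectivity. It suffices to find, for
  every vertex \<open>v\<close>, a deletable vertex other than \<open>v\<close> (lemma \<open>strong_delete_vertex_avoiding\<close>):
  a first application gives a deletable vertex \<open>i\<close>, and a second one, with \<open>v = i\<close>, gives another.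
  That lemma comes from growing a strong vertex set around \<open>v\<close> until it misses a single vertex.
\<close>

section \<open>Strong semicomplete digraphs\<close>

text \<open>
  Strong connectivity is expressed by cuts rather than by paths: a digraph is strong when every
  nonempty proper vertex set has an outgoing edge. Both halves of the link with
  efficiency produce or consume a cut.
\<close>

definition strong_on :: "('a \<Rightarrow> 'a \<Rightarrow> bool) \<Rightarrow> 'a set \<Rightarrow> bool" where
  "strong_on E S \<longleftrightarrow> (\<forall>X. X \<subset> S \<longrightarrow> X \<noteq> {} \<longrightarrow> (\<exists>x\<in>X. \<exists>y\<in>S - X. E x y))"

lemma strong_onD:
  assumes "strong_on E S" "X \<subset> S" "X \<noteq> {}"
  obtains x y where "x \<in> X" "y \<in> S" "y \<notin> X" "E x y"
  using assms unfolding strong_on_def by blast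

lemma strong_on_singleton: "strong_on E {v}"
  unfolding strong_on_def by blast

lemma strong_on_image:
  assumes "strong_on E (f ` S)" "inj_on f S"
  shows "strong_on (\<lambda>k l. E (f k) (f l)) S"
  unfolding strong_on_def
proof (intro allI impI)
  fix X assume X: "X \<subset> S" "X \<noteq> {}"
  have "f ` X \<subset> f ` S"
    using X assms(2) by (metis image_strict_mono)
  moreover have "f ` X \<noteq> {}"
    using X(2) by simp
  ultimately obtain x y where "x \<in> f ` X" "y \<in> f ` S" "y \<notin> f ` X" "E x y"
    by (rule strong_onD[OF assms(1)])
  then show "\<exists>x\<in>X. \<exists>y\<in>S - X. E (f x) (f y)"
    by blast
qed

text \<open>
  The case \<open>x = y\<close> attaches one vertex that has an edge in each direction with \<open>S\<close>; the other case
  attaches a detour of two vertices.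
\<close>

lemma strong_on_attach_detour:
  assumes S: "strong_on E S" and s: "s \<in> S" "s' \<in> S"
    and edges: "E s x" "x = y \<or> E x y" "E y s'"
  shows "strong_on E (S \<union> {x, y})"
  unfolding strong_on_def
proof (intro allI impI)
  fix X assume X: "X \<subset> S \<union> {x, y}" "X \<noteq> {}"
  consider "X \<inter> S = {}" | "X \<inter> S \<subset> S" "X \<inter> S \<noteq> {}" | "S \<subseteq> X"
    by blast
  then show "\<exists>p\<in>X. \<exists>q\<in>S \<union> {x, y} - X. E p q"
  proof cases
    case 1
    then show ?thesis using X s edges by blast
  next
    case 2
    obtain p q where "p \<in> X \<inter> S" "q \<in> S" "q \<notin> X \<inter> S" "E p q"
      by (rule strong_onD[OF S 2])
    then show ?thesis by blast
  next
    case 3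
    then show ?thesis using X s edges by blast
  qed
qed

text \<open>
  Every vertex of \<open>T\<close> lies on the triangle \<open>t \<rightarrow> x \<rightarrow> y \<rightarrow> t\<close>, and all these triangles share the
  edge from \<open>x\<close> to \<open>y\<close>; no edge inside \<open>T\<close> is used.
\<close>

lemma strong_on_triangles:
  assumes "T \<noteq> {}" "\<And>t. t \<in> T \<Longrightarrow> E t x" "\<And>t. t \<in> T \<Longrightarrow> E y t" "E x y"
  shows "strong_on E (T \<union> {x, y})"
  unfolding strong_on_def
proof (intro allI impI)
  fix X assume X: "X \<subset> T \<union> {x, y}" "X \<noteq> {}"
  show "\<exists>p\<in>X. \<exists>q\<in>T \<union> {x, y} - X. E p q"
  proof (rule ccontr)
    assume "\<not> ?thesis"
    then have closed: "q \<in> X" if "p \<in> X" "q \<in> T \<union> {x, y}" "E p q" for p q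
      using that by blast
    have x_y: "y \<in> X" if "x \<in> X"
      using closed[of x y] that assms(4) by blast
    have y_T: "T \<subseteq> X" if "y \<in> X"
      using closed[of y] that assms(3) by blast
    have T_x: "x \<in> X" if "t \<in> T" "t \<in> X" for t
      using closed[of t x] that assms(2) by blast
    have "x \<in> X \<and> y \<in> X \<and> T \<subseteq> X"
      using X x_y y_T T_x assms(1) by blast
    then show False
      using X by blast
  qed
qed

text \<open>
  A strong proper vertex set \<open>S\<close> containing \<open>v\<close>, of maximal size, misses just one vertex. Otherwise
  no outside vertex can be attached to it alone, so by semicompleteness each outside vertex is
  either entered from all of \<open>S\<close> or sends edges to all of \<open>S\<close>, with no edge the other way. The
  vertices of the first kind have an outgoing edge, from some \<open>x\<close> to some \<open>y\<close>, and \<open>y\<close> must be of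
  the second kind. Attaching \<open>x\<close> and \<open>y\<close> to \<open>S\<close> yields all of \<open>V\<close>, by maximality. Then the
  triangles through \<open>x\<close> and \<open>y\<close> keep \<open>V\<close> strong when any vertex of \<open>S\<close> other than \<open>v\<close> is
  deleted. Such a vertex exists because \<open>V\<close> has at least four vertices; for the directed
  triangle the claim fails.
\<close>

lemma strong_delete_vertex_avoiding:
  assumes fin: "finite V" and card: "card V \<ge> 4" and strong: "strong_on E V"
    and semicomplete: "\<And>a b. a \<in> V \<Longrightarrow> b \<in> V \<Longrightarrow> E a b \<or> E b a"
    and v: "v \<in> V"
  shows "\<exists>u\<in>V. u \<noteq> v \<and> strong_on E (V - {u})"
proof -
  let ?P = "\<lambda>S. S \<subset> V \<and> v \<in> S \<and> strong_on E S"
  have "V \<noteq> {v}"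
    using card by auto
  then have start: "?P {v}"
    using v by (simp add: strong_on_singleton psubset_eq)
  have bound: "\<forall>S. ?P S \<longrightarrow> card S < card V"
    using fin by (simp add: psubset_card_mono)
  have "\<exists>S. ?P S \<and> (\<forall>T. ?P T \<longrightarrow> card T \<le> card S)"
    by (rule ex_has_greatest_nat[of ?P "{v}" card, OF start bound])
  then obtain S where S: "?P S" and maximal: "\<And>T. ?P T \<Longrightarrow> card T \<le> card S"
    by auto
  have no_larger: "T = V" if "S \<subset> T" "T \<subseteq> V" "strong_on E T" for T
  proof (rule ccontr)
    assume "T \<noteq> V"
    then have "?P T" using that S by blast
    moreover have "card S < card T"
      using that fin by (meson finite_subset psubset_card_mono)
    ultimately show False using maximal[of T] by simp
  qed
  show ?thesis
  proof (cases "\<exists>x\<in>V - S. \<exists>s\<in>S. \<exists>s'\<in>S. E s x \<and> E x s'")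
    case True
    then obtain x s s' where x: "x \<in> V - S" "s \<in> S" "s' \<in> S" "E s x" "E x s'"
      by blast
    then have "strong_on E (S \<union> {x, x})"
      using S by (intro strong_on_attach_detour) auto
    then have "S \<union> {x} = V"
      using no_larger[of "S \<union> {x}"] x(1) S by auto
    then have "V - {x} = S"
      using x(1) by blast
    then show ?thesis
      using x(1) S by auto
  next
    case False
    define In where "In = {x \<in> V - S. \<exists>s\<in>S. E s x}"
    have SV: "S \<subset> V" "S \<noteq> {}"
      using S by auto
    have all_in: "E s x" if "x \<in> In" "s \<in> S" for x s
    proof -
      have "x \<in> V" "s \<in> V" "\<not> E x s"
        using that False SV unfolding In_def by auto
      then show ?thesis
        using semicomplete by metis
    qed
    have all_out: "E x s" if "x \<in> V - S - In" "s \<in> S" for x s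
    proof -
      have "x \<in> V" "s \<in> V" "\<not> E s x"
        using that SV unfolding In_def by auto
      then show ?thesis
        using semicomplete by metis
    qed
    obtain p q where "p \<in> S" "q \<in> V" "q \<notin> S" "E p q"
      by (rule strong_onD[OF strong SV])
    then have nonempty: "In \<noteq> {}"
      unfolding In_def by blast
    have proper: "In \<subset> V"
      using SV unfolding In_def by blast
    obtain x y where xy: "x \<in> In" "y \<in> V" "y \<notin> In" "E x y"
      by (rule strong_onD[OF strong proper nonempty])
    have x: "x \<in> V" "x \<notin> S"
      using xy(1) unfolding In_def by auto
    have y: "y \<in> V - S - In"
      using xy x False unfolding In_def by blast
    have "strong_on E (S \<union> {x, y})"
      using S all_in[OF xy(1)] all_out[OF y] xy(4) by (intro strong_on_attach_detour[of E S v v]) auto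
    then have V: "V = S \<union> {x, y}"
      using no_larger[of "S \<union> {x, y}"] x y S by blast
    have "S \<noteq> {v}"
    proof
      assume "S = {v}"
      then have "card V \<le> 3"
        using V card_length[of "[v, x, y]"] by (simp add: insert_commute)
      then show False using card by simp
    qed
    then obtain u where u: "u \<in> S" "u \<noteq> v"
      using S by blast
    have "strong_on E ((S - {u}) \<union> {x, y})"
      using u S all_in[OF xy(1)] all_out[OF y] xy(4) by (intro strong_on_triangles) auto
    moreover have "(S - {u}) \<union> {x, y} = V - {u}"
      using V u x y by blast
    ultimately show ?thesis
      using u S by auto
  qed
qed

section \<open>Efficiency as strong connectivity\<close>

definition ratio_edge :: "real mat \<Rightarrow> real vec \<Rightarrow> nat \<Rightarrow> nat \<Rightarrow> bool" where
  "ratio_edge A w i j \<longleftrightarrow> A $$ (i, j) \<le> w $ i / w $ j"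

lemma ratio_edge_semicomplete:
  assumes "A \<in> reciprocal_mats n" "w \<in> positive_vecs n" "i < n" "j < n"
  shows "ratio_edge A w i j \<or> ratio_edge A w j i"
proof -
  have "A $$ (i, j) > 0" "A $$ (j, i) = 1 / A $$ (i, j)" "w $ i > 0" "w $ j > 0"
    using assms unfolding reciprocal_mats_def positive_vecs_def by blast+
  moreover have "1 / A $$ (i, j) \<le> w $ j / w $ i" if "w $ i / w $ j \<le> A $$ (i, j)"
    using calculation that by (simp add: pos_divide_le_eq pos_le_divide_eq mult.commute)
  ultimately show ?thesis
    unfolding ratio_edge_def by linarith
qed

text \<open>
  A vertex set \<open>X\<close> without outgoing edges has \<open>w\<^sub>i / w\<^sub>j < a\<^sub>i\<^sub>j\<close> for all \<open>i\<close> in \<open>X\<close> and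
  \<open>j\<close> outside. Multiplying the entries of \<open>w\<close> in \<open>X\<close> by a common factor above 1, small enough that none of
  these ratios passes \<open>a\<^sub>i\<^sub>j\<close>, moves all of them towards \<open>a\<^sub>i\<^sub>j\<close>, by reciprocity moves the
  inverse ratios towards \<open>a\<^sub>j\<^sub>i\<close>, and leaves the other ratios alone.
\<close>

lemma efficient_imp_strong:
  assumes A: "A \<in> reciprocal_mats n" and w: "w \<in> efficient_vecs A"
  shows "strong_on (ratio_edge A w) {..<n}"
  unfolding strong_on_def
proof (intro allI impI)
  fix X assume X: "X \<subset> {..<n}" "X \<noteq> {}"
  have dim: "dim_row A = n"
    using A unfolding reciprocal_mats_def by auto
  have Apos: "A $$ (i, j) > 0" and Arec: "A $$ (j, i) = 1 / A $$ (i, j)" if "i < n" "j < n" for i j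
    using A that unfolding reciprocal_mats_def by blast+
  have wcarrier: "dim_vec w = n" and wpos: "\<And>i. i < n \<Longrightarrow> w $ i > 0"
    using w dim unfolding efficient_vecs_def positive_vecs_def by auto
  show "\<exists>i\<in>X. \<exists>j\<in>{..<n} - X. ratio_edge A w i j"
  proof (rule ccontr)
    assume "\<not> ?thesis"
    then have less: "w $ i / w $ j < A $$ (i, j)" if "i \<in> X" "j \<in> {..<n} - X" for i j
      using that unfolding ratio_edge_def by force
    let ?Q = "(\<lambda>(i, j). A $$ (i, j) * w $ j / w $ i) ` (X \<times> ({..<n} - X))"
    define c where "c = Min ?Q"
    have Q: "finite ?Q" "?Q \<noteq> {}"
      using X finite_subset[of X "{..<n}"] by auto
    have "1 < q" if "q \<in> ?Q" for q
    proof -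
      obtain i j where ij: "i \<in> X" "j \<in> {..<n} - X" "q = A $$ (i, j) * w $ j / w $ i"
        using \<open>q \<in> ?Q\<close> by auto
      moreover have "w $ i > 0" "w $ j > 0"
        using ij X wpos by auto
      moreover have "w $ i / w $ j < A $$ (i, j)"
        using less ij by blast
      ultimately show ?thesis
        by (simp add: pos_less_divide_eq pos_divide_less_eq)
    qed
    then have c1: "c > 1"
      unfolding c_def using Q by simp
    have c_le: "c * (w $ i / w $ j) \<le> A $$ (i, j)" if "i \<in> X" "j \<in> {..<n} - X" for i j
    proof -
      have "c \<le> A $$ (i, j) * w $ j / w $ i"
        unfolding c_def using that by (intro Min_le Q(1)) force
      moreover have "w $ i > 0" "w $ j > 0"
        using that X wpos by auto
      ultimately show ?thesis
        by (simp add: field_simps)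
    qed
    define v where "v = vec n (\<lambda>i. if i \<in> X then c * w $ i else w $ i)"
    have v: "v $ i = (if i \<in> X then c * w $ i else w $ i)" if "i < n" for i
      using that by (simp add: v_def)
    have vpos: "v \<in> positive_vecs n"
      unfolding positive_vecs_def using wpos c1 by (auto simp: v_def)
    have "\<bar>A $$ (i, j) - v $ i / v $ j\<bar> \<le> \<bar>A $$ (i, j) - w $ i / w $ j\<bar>" if ij: "i < n" "j < n" for i j
    proof -
      note pos = wpos[OF ij(1)] wpos[OF ij(2)]
      consider "i \<in> X" "j \<in> X" | "i \<notin> X" "j \<notin> X" | "i \<in> X" "j \<notin> X" | "i \<notin> X" "j \<in> X"
        by blast
      then show ?thesis
      proof cases
        case 1
        then show ?thesis using ij c1 by (simp add: v)
      next
        case 2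
        then show ?thesis using ij by (simp add: v)
      next
        case 3
        have "w $ i / w $ j \<le> c * (w $ i / w $ j)"
          using c1 pos by (simp add: field_simps)
        moreover have "v $ i / v $ j = c * (w $ i / w $ j)"
          using 3 ij by (simp add: v)
        ultimately show ?thesis
          using c_le[of i j] 3 ij by auto
      next
        case 4
        have "c * (w $ j / w $ i) \<le> 1 / A $$ (i, j)"
          using c_le[of j i] 4 ij Arec[OF ij] by simp
        then have "A $$ (i, j) \<le> (w $ i / w $ j) / c"
          using pos c1 Apos[OF ij] by (simp add: field_simps)
        moreover have "(w $ i / w $ j) / c \<le> w $ i / w $ j"
          using c1 pos by (simp add: field_simps)
        moreover have "v $ i / v $ j = (w $ i / w $ j) / c"
          using 4 ij by (simp add: v)
        ultimately show ?thesis
          by auto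
      qed
    qed
    then have "proportional v w"
      using w vpos dim unfolding efficient_vecs_def by simp
    then obtain d where d: "v = d \<cdot>\<^sub>v w"
      unfolding proportional_def by blast
    obtain i j where ij: "i \<in> X" "i < n" "j < n" "j \<notin> X"
      using X by blast
    have "c * w $ i = d * w $ i" "w $ j = d * w $ j"
      using v[OF ij(2)] v[OF ij(3)] ij d wcarrier by auto
    then show False
      using wpos[OF ij(2)] wpos[OF ij(3)] c1 by simp
  qed
qed

text \<open>
  If \<open>v\<close> approximates \<open>A\<close> at least as well as \<open>w\<close>, then an edge from \<open>i\<close> to \<open>j\<close>, where
  \<open>w\<^sub>i / w\<^sub>j\<close> is already too large or exact, forces \<open>v\<^sub>i / v\<^sub>j \<le> w\<^sub>i / w\<^sub>j\<close>, so \<open>v\<^sub>j / w\<^sub>j\<close> is not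
  below \<open>v\<^sub>i / w\<^sub>i\<close>. Hence no edge leaves the set where \<open>v\<^sub>i / w\<^sub>i\<close> is maximal, and by strong
  connectivity this set contains every index.
\<close>

lemma strong_imp_efficient:
  assumes dim: "dim_row A = n" and w: "w \<in> positive_vecs n"
    and strong: "strong_on (ratio_edge A w) {..<n}"
  shows "w \<in> efficient_vecs A"
proof -
  have wcarrier: "dim_vec w = n" and wpos: "\<And>i. i < n \<Longrightarrow> w $ i > 0"
    using w unfolding positive_vecs_def by auto
  have "proportional v w" if v: "v \<in> positive_vecs n"
    and better: "\<forall>i<n. \<forall>j<n. \<bar>A $$ (i, j) - v $ i / v $ j\<bar> \<le> \<bar>A $$ (i, j) - w $ i / w $ j\<bar>" for v
  proof -
    have vcarrier: "dim_vec v = n" and vpos: "\<And>i. i < n \<Longrightarrow> v $ i > 0"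
      using v unfolding positive_vecs_def by auto
    define r where "r i = v $ i / w $ i" for i
    have mono: "r i \<le> r j" if "i < n" "j < n" "ratio_edge A w i j" for i j
    proof -
      have "v $ i / v $ j \<le> w $ i / w $ j"
        using better that unfolding ratio_edge_def by fastforce
      then show ?thesis
        unfolding r_def using wpos[OF that(1)] wpos[OF that(2)] vpos[OF that(1)] vpos[OF that(2)]
        by (simp add: field_simps)
    qed
    define m where "m = Max (r ` {..<n})"
    have r_le: "r i \<le> m" if "i < n" for i
      unfolding m_def using that by simp
    have all: "r i = m" if i: "i < n" for i
    proof (rule ccontr)
      assume "r i \<noteq> m"
      let ?X = "{k. k < n \<and> r k = m}"
      have "m \<in> r ` {..<n}"
        unfolding m_def using i by (intro Max_in) auto
      then have nonempty: "?X \<noteq> {}" by auto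
      have proper: "?X \<subset> {..<n}"
        using i \<open>r i \<noteq> m\<close> by auto
      obtain k l where "k \<in> ?X" "l \<in> {..<n}" "l \<notin> ?X" "ratio_edge A w k l"
        by (rule strong_onD[OF strong proper nonempty])
      then show False
        using mono[of k l] r_le[of l] by auto
    qed
    have "v = m \<cdot>\<^sub>v w"
    proof (rule eq_vecI)
      show "v $ i = (m \<cdot>\<^sub>v w) $ i" if "i < dim_vec (m \<cdot>\<^sub>v w)" for i
        using that all[of i] wpos[of i] wcarrier by (auto simp: r_def field_simps)
    qed (simp add: vcarrier wcarrier)
    then show ?thesis
      unfolding proportional_def by blast
  qed
  then show ?thesis
    using w unfolding efficient_vecs_def dim by blast
qed

lemma strong_delete_imp_efficient:
  assumes A: "A \<in> reciprocal_mats n" and w: "w \<in> positive_vecs n" and i: "i < n"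
    and strong: "strong_on (ratio_edge A w) ({..<n} - {i})"
  shows "vec_delete w i \<in> efficient_vecs (mat_delete A i i)"
proof (rule strong_imp_efficient)
  let ?f = "\<lambda>k. if k < i then k else Suc k"
  have Acarrier: "A \<in> carrier_mat n n"
    using A unfolding reciprocal_mats_def by blast
  have wcarrier: "dim_vec w = n"
    using w unfolding positive_vecs_def by auto
  show "dim_row (mat_delete A i i) = n - 1"
    using mat_delete_carrier[OF Acarrier] by (rule carrier_matD(1))
  show "vec_delete w i \<in> positive_vecs (n - 1)"
    using w i by (rule vec_delete_positive)
  have inj: "inj_on ?f {..<n - 1}"
    by (auto simp: inj_on_def split: if_splits)
  have image: "?f ` {..<n - 1} = {..<n} - {i}"
  proof (intro card_subset_eq)
    show "?f ` {..<n - 1} \<subseteq> {..<n} - {i}"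
      using i by auto
    show "card (?f ` {..<n - 1}) = card ({..<n} - {i})"
      using i by (subst card_image[OF inj]) simp
  qed simp
  have edge: "ratio_edge (mat_delete A i i) (vec_delete w i) k l \<longleftrightarrow> ratio_edge A w (?f k) (?f l)"
    if "k < n - 1" "l < n - 1" for k l
    using that Acarrier wcarrier
    unfolding ratio_edge_def mat_delete_def vec_delete_def by simp
  have "strong_on (\<lambda>k l. ratio_edge A w (?f k) (?f l)) {..<n - 1}"
    using strong unfolding image[symmetric] by (rule strong_on_image[OF _ inj])
  then show "strong_on (ratio_edge (mat_delete A i i) (vec_delete w i)) {..<n - 1}"
    unfolding strong_on_def using edge by (meson Diff_iff lessThan_iff psubset_imp_subset subsetD)
qed

section \<open>Two deletable indices\<close>

theorem theorem10:
  fixes n :: nat and A :: "real mat" and w :: "real vec"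
  assumes "n \<ge> 4"
    and "A \<in> reciprocal_mats n"
    and "w \<in> efficient_vecs A"
  shows "\<exists>i<n. \<exists>j<n. i \<noteq> j \<and>
           vec_delete w i \<in> efficient_vecs (mat_delete A i i) \<and>
           vec_delete w j \<in> efficient_vecs (mat_delete A j j) \<and>
           w \<in> efficient_vecs_at A i \<inter> efficient_vecs_at A j"
proof -
  have "dim_row A = n"
    using assms(2) unfolding reciprocal_mats_def by auto
  then have w: "w \<in> positive_vecs n"
    using assms(3) unfolding efficient_vecs_def by auto
  have strong: "strong_on (ratio_edge A w) {..<n}"
    using assms(2,3) by (rule efficient_imp_strong)
  have deletable: "\<exists>u<n. u \<noteq> v \<and> vec_delete w u \<in> efficient_vecs (mat_delete A u u)"
    if "v < n" for v
  proof -
    have "\<exists>u\<in>{..<n}. u \<noteq> v \<and> strong_on (ratio_edge A w) ({..<n} - {u})"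
      using assms(1) strong ratio_edge_semicomplete[OF assms(2) w] that
      by (intro strong_delete_vertex_avoiding) auto
    then show ?thesis
      using strong_delete_imp_efficient[OF assms(2) w] by blast
  qed
  obtain i where i: "i < n" "vec_delete w i \<in> efficient_vecs (mat_delete A i i)"
    using deletable[of 0] assms(1) by auto
  obtain j where j: "j < n" "j \<noteq> i" "vec_delete w j \<in> efficient_vecs (mat_delete A j j)"
    using deletable[OF i(1)] by blast
  show ?thesis
    using i j assms(3) unfolding efficient_vecs_at_def by blast
qed

end
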